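(* Let $b_i>0$ $(0\le i\le N)$ and $\lambda_j>0$ $(1\le j\le N)$ be real numbers with associated Motzkin path weights $(\mu_{m,i})$. Suppose that $z=(z_0,\dots,z_N)\ge0$ (all entries nonnegative). The entries of the formal $h$-vector $(h_0,\dots,h_N)$ associated to $z$ form a monotonically increasing sequence if and only if $$z_{\ell-1}\ge-\frac12\left((2\mu_{\ell,\ell-1}-1)z_\ell+(2\mu_{\ell+1,\ell-1}-\mu_{\ell+1,\ell})z_{\ell+1}+\dots+(2\mu_{N,\ell-1}-\mu_{N,\ell})z_N\right)$$ for all $1\le\ell\le N$. This indicates that nonnegative entries that decrease sufficiently quickly are realized as nonnegative generalized inverted gamma vectors of monotonically increasing formal $h$-vector entries $(h_0,\dots,h_N)$. If $2\mu_{r-1,s}\le\mu_{r,s}$ for all $0\le r,s\le N$, the inequality above would hold for all $z\ge0$.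
   Context: $\mu_{m,i}$ is the sum, over Motzkin paths of length $m$ from level $0$ to level $i$ (never going below level $0$), of the products of step weights: a northeast step has weight 1, an east step at level $r$ has weight $b_r$, a southeast step starting at level $r$ has weight $\lambda_r$; $\mu_{m,i}=0$ if $m<i$ or if some index lies outside $[0,N]$, and $\mu_{m,m}=1$. Equivalently $(\mu_{m,i})_{0\le m,i\le N}=P^{-1}$, where $P$ has $(m,i)$ entry the coefficient of $x^i$ in the unitary orthogonal polynomial $P_m(x)$, with $P_0=1$, $P_1=x-b_0$, $P_{m+1}=(x-b_m)P_m-\lambda_mP_{m-1}$. For a row vector $z$ put $q=z\cdot P^{-1}$, i.e. $q_\ell=\sum_{m=\ell}^N z_m\mu_{m,\ell}$. The formal $h$-vector associated to $z$ is $(h_0,\dots,h_N)$ with $q=(h_N,2h_{N-1},\dots,2^{N-1}h_1,2^Nh_0)$, i.e. $h_k=2^{-(N-k)}q_{N-k}$; given such an $h$, $z$ is called the generalized inverted gamma vector associated to the collection $P_0,\dots,P_N$.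
   Formalization: In the last sentence the condition $2\mu_{r-1,s}\le\mu_{r,s}$ is replaced by $\mu_{r,s}\le2\mu_{r,s-1}$ ($0\le r\le N$, $1\le s\le N$); as printed it fails for $N=2$, $b=(2,1000,1000)$, $\lambda=(1,1)$, $z=(0,0,1)$. *)

theory Defs
  imports Complex_Main "HOL-Computational_Algebra.Polynomial"
begin

text \<open>A Motzkin path is encoded by its starting level and its list of steps; being a path from
  level r to level i without going below level 0 is a property of that list.\<close>

datatype step = North_East | East | South_East

primrec motzkin_path :: "nat \<Rightarrow> step list \<Rightarrow> nat \<Rightarrow> bool" where
  "motzkin_path r [] i \<longleftrightarrow> r = i"
| "motzkin_path r (s # p) i \<longleftrightarrow>
     (case s of
        North_East \<Rightarrow> motzkin_path (r + 1) p i
      | East \<Rightarrow> motzkin_path r p i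
      | South_East \<Rightarrow> r > 0 \<and> motzkin_path (r - 1) p i)"

primrec path_weight :: "(nat \<Rightarrow> real) \<Rightarrow> (nat \<Rightarrow> real) \<Rightarrow> nat \<Rightarrow> step list \<Rightarrow> real" where
  "path_weight b lam r [] = 1"
| "path_weight b lam r (s # p) =
     (case s of
        North_East \<Rightarrow> path_weight b lam (r + 1) p
      | East \<Rightarrow> b r * path_weight b lam r p
      | South_East \<Rightarrow> lam r * path_weight b lam (r - 1) p)"

text \<open>By convention this is 0 outside the index range 0, ..., N; it also vanishes for m < i,
  since then there is no path to sum over.\<close>

definition motzkin_mu :: "nat \<Rightarrow> (nat \<Rightarrow> real) \<Rightarrow> (nat \<Rightarrow> real) \<Rightarrow> nat \<Rightarrow> nat \<Rightarrow> real" where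
  "motzkin_mu N b lam m i =
     (if m \<le> N \<and> i \<le> N
      then \<Sum>p | length p = m \<and> motzkin_path 0 p i. path_weight b lam 0 p
      else 0)"

fun orth_poly :: "(nat \<Rightarrow> real) \<Rightarrow> (nat \<Rightarrow> real) \<Rightarrow> nat \<Rightarrow> real poly" where
  "orth_poly b lam 0 = 1"
| "orth_poly b lam (Suc 0) = [:- b 0, 1:]"
| "orth_poly b lam (Suc (Suc m)) =
     [:- b (Suc m), 1:] * orth_poly b lam (Suc m) - smult (lam (Suc m)) (orth_poly b lam m)"

text \<open>Vectors indexed by 0, ..., N are functions on the naturals of which only the values at
  0, ..., N matter. The vector q below is z times the inverse of P, where P is the matrix
  whose (m, i) entry is the coefficient of x^i in the m-th orthogonal polynomial; the entries
  of this inverse are the Motzkin path sums.\<close>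

definition q_vec ::
  "nat \<Rightarrow> (nat \<Rightarrow> real) \<Rightarrow> (nat \<Rightarrow> real) \<Rightarrow> (nat \<Rightarrow> real) \<Rightarrow> nat \<Rightarrow> real" where
  "q_vec N b lam z l = (\<Sum>m = l..N. z m * motzkin_mu N b lam m l)"

definition formal_h ::
  "nat \<Rightarrow> (nat \<Rightarrow> real) \<Rightarrow> (nat \<Rightarrow> real) \<Rightarrow> (nat \<Rightarrow> real) \<Rightarrow> nat \<Rightarrow> real" where
  "formal_h N b lam z k = q_vec N b lam z (N - k) / 2 ^ (N - k)"

text \<open>Here z is recovered from h as z = q P, where q l = 2^l * h (N - l).\<close>

definition gen_inverted_gamma ::
  "nat \<Rightarrow> (nat \<Rightarrow> real) \<Rightarrow> (nat \<Rightarrow> real) \<Rightarrow> (nat \<Rightarrow> real) \<Rightarrow> (nat \<Rightarrow> real) \<Rightarrow> bool" where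
  "gen_inverted_gamma N b lam h z \<longleftrightarrow>
     (\<forall>i\<le>N. z i = (\<Sum>l = 0..N. 2 ^ l * h (N - l) * coeff (orth_poly b lam l) i))"

end

theory Submission imports Defs begin

text \<open>Extending the path sums to arbitrary starting levels, splitting off the first step of a
  path mirrors the three-term recurrence of the polynomials, so x^m P_r is the sum over i of the
  path sums from r to i times P_i. For r = 0 this says that the path sums form the inverse of the
  coefficient matrix. The inequality of the statement for an index l is q_l \<le> 2 q_{l-1},
  which is h_{N-l} \<le> h_{N-l+1}.\<close>

section \<open>Motzkin path sums from an arbitrary starting level\<close>

definition motzkin_sum ::
  "(nat \<Rightarrow> real) \<Rightarrow> (nat \<Rightarrow> real) \<Rightarrow> nat \<Rightarrow> nat \<Rightarrow> nat \<Rightarrow> real" where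
  "motzkin_sum b lam r m i =
     (\<Sum>p | length p = m \<and> motzkin_path r p i. path_weight b lam r p)"

lemma motzkin_mu_eq_sum:
  "m \<le> N \<Longrightarrow> i \<le> N \<Longrightarrow> motzkin_mu N b lam m i = motzkin_sum b lam 0 m i"
  by (simp add: motzkin_mu_def motzkin_sum_def)

lemma motzkin_sum_0: "motzkin_sum b lam r 0 i = (if r = i then 1 else 0)"
proof -
  have "{p. length p = 0 \<and> motzkin_path r p i} = (if r = i then {[]} else {})"
    by auto
  then show ?thesis
    by (simp add: motzkin_sum_def)
qed

text \<open>There are only finitely many lists of length \<open>m\<close> over three steps.
  Finiteness matters because a sum over an infinite set is 0 by default and could not be
  split.\<close>

lemma finite_motzkin_paths: "finite {p. length p = m \<and> motzkin_path r p i}"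
proof (rule finite_subset)
  have "s \<in> {North_East, East, South_East}" for s
    by (cases s) auto
  then show "{p. length p = m \<and> motzkin_path r p i}
      \<subseteq> {p. set p \<subseteq> {North_East, East, South_East} \<and> length p = m}"
    by blast
  show "finite {p. set p \<subseteq> {North_East, East, South_East} \<and> length p = m}"
    by (rule finite_lists_length_eq) simp
qed

text \<open>The first step divides the paths into three disjoint images under \<open>Cons\<close>.
  The guard \<open>r > 0\<close> is essential: \<open>0 - 1 = 0\<close> on the naturals, so an
  unguarded last term would count southeast steps from level 0.\<close>

lemma motzkin_sum_Suc:
  "motzkin_sum b lam r (Suc m) i =
     motzkin_sum b lam (Suc r) m i + b r * motzkin_sum b lam r m i
     + (if r > 0 then lam r * motzkin_sum b lam (r - 1) m i else 0)"
proof -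
  let ?S = "\<lambda>r. {p. length p = m \<and> motzkin_path r p i}"
  let ?D = "if r > 0 then ?S (r - 1) else {}"
  let ?w = "path_weight b lam r"
  have split: "{p. length p = Suc m \<and> motzkin_path r p i} =
      (Cons North_East ` ?S (Suc r) \<union> Cons East ` ?S r) \<union> Cons South_East ` ?D"
    (is "?L = ?R")
  proof (intro set_eqI iffI)
    fix p assume "p \<in> ?L"
    then obtain s p' where p: "p = s # p'" "length p' = m" "motzkin_path r (s # p') i"
      by (cases p) auto
    then show "p \<in> ?R"
      by (cases s) auto
  qed (auto split: if_splits)
  have fin: "finite (?S r)" for r
    by (rule finite_motzkin_paths)
  have "motzkin_sum b lam r (Suc m) i =
      sum ?w (Cons North_East ` ?S (Suc r) \<union> Cons East ` ?S r) + sum ?w (Cons South_East ` ?D)"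
    unfolding motzkin_sum_def split using fin by (intro sum.union_disjoint) auto
  also have "sum ?w (Cons North_East ` ?S (Suc r) \<union> Cons East ` ?S r) =
      sum ?w (Cons North_East ` ?S (Suc r)) + sum ?w (Cons East ` ?S r)"
    using fin by (intro sum.union_disjoint) auto
  also have "sum ?w (Cons North_East ` ?S (Suc r)) = motzkin_sum b lam (Suc r) m i"
    by (simp add: sum.reindex motzkin_sum_def)
  also have "sum ?w (Cons East ` ?S r) = b r * motzkin_sum b lam r m i"
    by (simp add: sum.reindex motzkin_sum_def sum_distrib_left)
  also have "sum ?w (Cons South_East ` ?D) =
      (if r > 0 then lam r * motzkin_sum b lam (r - 1) m i else 0)"
    by (simp add: sum.reindex motzkin_sum_def sum_distrib_left)
  finally show ?thesis .
qed

text \<open>A step raises the level by at most one.\<close>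

lemma motzkin_sum_eq_0: "r + m < i \<Longrightarrow> motzkin_sum b lam r m i = 0"
  by (induction m arbitrary: r) (auto simp: motzkin_sum_0 motzkin_sum_Suc)

text \<open>Only the path of northeast steps alone climbs \<open>m\<close> levels in
  \<open>m\<close> steps, and its weight is 1.\<close>

lemma motzkin_sum_top: "motzkin_sum b lam r m (r + m) = 1"
proof (induction m arbitrary: r)
  case (Suc m)
  then show ?case
    using Suc[of "Suc r"] by (simp add: motzkin_sum_Suc motzkin_sum_eq_0)
qed (simp add: motzkin_sum_0)

lemma motzkin_mu_diag: "l \<le> N \<Longrightarrow> motzkin_mu N b lam l l = 1"
  using motzkin_sum_top[of b lam 0 l] by (simp add: motzkin_mu_eq_sum)

section \<open>Path sums as the inverse of the coefficient matrix\<close>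

text \<open>The three-term recurrence solved for x P_r, with the same weights and the same guard at
  level 0 as in \<open>motzkin_sum_Suc\<close>.\<close>

lemma X_times_orth_poly:
  "[:0, 1:] * orth_poly b lam r =
     orth_poly b lam (Suc r) + smult (b r) (orth_poly b lam r)
     + (if r > 0 then smult (lam r) (orth_poly b lam (r - 1)) else 0)"
  by (cases r) simp_all

lemma smult_sum_right: "smult c (\<Sum>i\<in>A. f i) = (\<Sum>i\<in>A. smult c (f i))"
  by (induction A rule: infinite_finite_induct) (simp_all add: smult_add_right)

text \<open>The bound \<open>K\<close> stays fixed during the induction, so that the three sums
  arising from starts \<open>r + 1\<close>, \<open>r\<close> and \<open>r - 1\<close> have one
  common range and add termwise. Levels out of reach contribute 0.\<close>

lemma X_power_times_orth_poly:
  "r + m \<le> K \<Longrightarrow>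
     [:0, 1:] ^ m * orth_poly b lam r =
       (\<Sum>i\<le>K. smult (motzkin_sum b lam r m i) (orth_poly b lam i))"
proof (induction m arbitrary: r)
  case 0
  have "(\<Sum>i\<le>K. smult (motzkin_sum b lam r 0 i) (orth_poly b lam i)) =
      (\<Sum>i\<le>K. if r = i then orth_poly b lam i else 0)"
    by (intro sum.cong) (auto simp: motzkin_sum_0)
  with 0 show ?case
    by simp
next
  case (Suc m)
  let ?P = "orth_poly b lam"
  have "[:0, 1:] ^ Suc m * ?P r = [:0, 1:] ^ m * ([:0, 1:] * ?P r)"
    by (simp only: power_Suc2 mult.assoc)
  also have "\<dots> = [:0, 1:] ^ m * ?P (Suc r) + smult (b r) ([:0, 1:] ^ m * ?P r)
      + (if r > 0 then smult (lam r) ([:0, 1:] ^ m * ?P (r - 1)) else 0)"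
    unfolding X_times_orth_poly
    by (cases "r > 0") (simp_all only: distrib_left mult_smult_right mult_zero_right if_True if_False)
  also have "\<dots> = (\<Sum>i\<le>K. smult (motzkin_sum b lam r (Suc m) i) (?P i))"
    using Suc.prems
    by (auto simp: Suc.IH motzkin_sum_Suc smult_sum_right smult_add_left sum.distrib)
  finally show ?case .
qed

text \<open>Multiplying q by P undoes the multiplication of z by the inverse of P. This makes
  \<open>formal_h\<close> a witness for the existence of h.\<close>

lemma gen_inverted_gamma_formal_h:
  "gen_inverted_gamma N b lam (formal_h N b lam z) z"
  unfolding gen_inverted_gamma_def
proof (intro allI impI)
  fix i assume i: "i \<le> N"
  let ?M = "motzkin_sum b lam 0" and ?c = "\<lambda>l. coeff (orth_poly b lam l) i"
  \<comment> \<open>The range is extended to all \<open>m \<le> N\<close>, the new terms being 0, so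
    that the double sum runs over a square and can be swapped.\<close>
  have q: "q_vec N b lam z l = (\<Sum>m\<le>N. z m * ?M m l)" if "l \<le> N" for l
  proof -
    have "q_vec N b lam z l = (\<Sum>m = l..N. z m * ?M m l)"
      using that unfolding q_vec_def by (intro sum.cong) (auto simp: motzkin_mu_eq_sum)
    also have "\<dots> = (\<Sum>m\<le>N. z m * ?M m l)"
      by (rule sum.mono_neutral_left) (auto simp: motzkin_sum_eq_0)
    finally show ?thesis .
  qed
  have "(\<Sum>l = 0..N. 2 ^ l * formal_h N b lam z (N - l) * ?c l) =
      (\<Sum>l\<le>N. \<Sum>m\<le>N. z m * (?M m l * ?c l))"
    unfolding atLeast0AtMost
    by (intro sum.cong) (auto simp: formal_h_def q sum_distrib_right mult.assoc)
  also have "\<dots> = (\<Sum>m\<le>N. z m * (\<Sum>l\<le>N. ?M m l * ?c l))"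
    by (subst sum.swap) (simp add: sum_distrib_left)
  also have "\<dots> = (\<Sum>m\<le>N. if m = i then z m else 0)"
  proof (intro sum.cong refl)
    fix m assume "m \<in> {..N}"
    \<comment> \<open>The expansion of x^m, compared at x^i, gives entry (m, i) of the identity
      matrix.\<close>
    then have "monom 1 m = (\<Sum>l\<le>N. smult (?M m l) (orth_poly b lam l))"
      using X_power_times_orth_poly[of 0 m N b lam] by (simp add: monom_altdef)
    from arg_cong[OF this, of "\<lambda>p. coeff p i"]
    have "(\<Sum>l\<le>N. ?M m l * ?c l) = (if m = i then 1 else 0)"
      by (simp add: coeff_sum)
    then show "z m * (\<Sum>l\<le>N. ?M m l * ?c l) = (if m = i then z m else 0)"
      by simp
  qed
  also have "\<dots> = z i"
    using i by simp
  finally show "z i = (\<Sum>l = 0..N. 2 ^ l * formal_h N b lam z (N - l) * ?c l)"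
    by simp
qed

section \<open>Monotonicity of h as linear inequalities in z\<close>

lemma q_vec_eq:
  assumes "l \<le> N"
  shows "q_vec N b lam z l = z l + (\<Sum>m = Suc l..N. z m * motzkin_mu N b lam m l)"
  using assms by (simp add: q_vec_def sum.atLeast_Suc_atMost motzkin_mu_diag)

lemma mono_on_atLeastAtMost_iff_Suc:
  fixes f :: "nat \<Rightarrow> 'a::order"
  shows "mono_on {0..N} f \<longleftrightarrow> (\<forall>k<N. f k \<le> f (Suc k))"
proof
  assume R: "\<forall>k<N. f k \<le> f (Suc k)"
  show "mono_on {0..N} f"
  proof (rule mono_onI)
    fix r s assume "r \<in> {0..N}" "s \<in> {0..N}" "r \<le> s"
    from \<open>r \<le> s\<close> show "f r \<le> f s"
      using \<open>s \<in> {0..N}\<close>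
    proof (induction s rule: dec_induct)
      case (step s)
      then have "f r \<le> f s" "f s \<le> f (Suc s)"
        using R by auto
      then show ?case
        by (rule order_trans)
    qed simp
  qed
qed (auto simp: mono_on_def)

text \<open>Passing from h_k to h_{k+1} lowers the index of q from l = N - k to l - 1 and halves the
  denominator, which produces the factor 2.\<close>

lemma mono_on_formal_h_iff_q_vec:
  "mono_on {0..N} (formal_h N b lam z) \<longleftrightarrow>
     (\<forall>l\<in>{1..N}. q_vec N b lam z l \<le> 2 * q_vec N b lam z (l - 1))"
proof -
  let ?q = "q_vec N b lam z" and ?h = "formal_h N b lam z"
  have step: "?h k \<le> ?h (Suc k) \<longleftrightarrow> ?q (N - k) \<le> 2 * ?q (N - k - 1)" if "k < N" for k
  proof -
    from that obtain j where j: "N - k = Suc j" "N - Suc k = j"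
      by (metis Suc_diff_Suc)
    then show ?thesis
      by (simp add: formal_h_def divide_simps mult.commute)
  qed
  show ?thesis
    unfolding mono_on_atLeastAtMost_iff_Suc
  proof (intro iffI ballI allI impI)
    fix l assume h: "\<forall>k<N. ?h k \<le> ?h (Suc k)" and l: "l \<in> {1..N}"
    then show "?q l \<le> 2 * ?q (l - 1)"
      using step[of "N - l"] by auto
  next
    fix k assume "\<forall>l\<in>{1..N}. ?q l \<le> 2 * ?q (l - 1)" and k: "k < N"
    then have "?q (N - k) \<le> 2 * ?q (N - k - 1)"
      by (elim ballE[of _ _ "N - k"]) auto
    then show "?h k \<le> ?h (Suc k)"
      using step[OF k] by simp
  qed
qed

text \<open>Solving for \<open>z (l - 1)\<close>, whose coefficient in q_{l-1} is 1. The 1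
  subtracted in the coefficient of \<open>z l\<close> is the diagonal entry mu_{l,l}.\<close>

lemma q_vec_le_iff:
  assumes "l \<in> {1..N}"
  shows "q_vec N b lam z l \<le> 2 * q_vec N b lam z (l - 1) \<longleftrightarrow>
    z (l - 1) \<ge> - (1 / 2) * ((2 * motzkin_mu N b lam l (l - 1) - 1) * z l
      + (\<Sum>m = l + 1..N. (2 * motzkin_mu N b lam m (l - 1) - motzkin_mu N b lam m l) * z m))"
proof -
  let ?mu = "motzkin_mu N b lam"
  from assms have l: "1 \<le> l" "l \<le> N" "l - 1 \<le> N" "Suc (l - 1) = l"
    by auto
  have q: "q_vec N b lam z l = z l + (\<Sum>m = l + 1..N. z m * ?mu m l)"
    using l by (simp add: q_vec_eq)
  have q': "q_vec N b lam z (l - 1) =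
      z (l - 1) + (z l * ?mu l (l - 1) + (\<Sum>m = l + 1..N. z m * ?mu m (l - 1)))"
    using l by (simp add: q_vec_eq sum.atLeast_Suc_atMost[of l])
  have diff: "(\<Sum>m = l + 1..N. (2 * ?mu m (l - 1) - ?mu m l) * z m) =
      2 * (\<Sum>m = l + 1..N. z m * ?mu m (l - 1)) - (\<Sum>m = l + 1..N. z m * ?mu m l)"
    by (simp add: algebra_simps sum_subtractf sum_distrib_left)
  show ?thesis
    unfolding q q' diff by (simp add: field_simps)
qed

section \<open>Sufficient conditions for the inequalities\<close>

text \<open>Makes "decrease sufficiently quickly" precise as a geometric rate \<open>C\<close>,
  chosen before \<open>z\<close> and thus depending only on \<open>N\<close>, \<open>b\<close> and
  \<open>lam\<close>.\<close>

lemma mono_on_formal_h_if_rapid_decrease: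
  "\<exists>C\<ge>1. \<forall>z. (\<forall>i\<in>{0..N}. z i \<ge> 0) \<longrightarrow> (\<forall>l\<in>{1..N}. z (l - 1) \<ge> C * z l) \<longrightarrow>
     mono_on {0..N} (formal_h N b lam z)"
proof -
  let ?mu = "motzkin_mu N b lam"
  \<comment> \<open>For \<open>m \<ge> l \<ge> 1\<close>, this is the coefficient of
    \<open>z m\<close> in 2 q_{l-1} - q_l.\<close>
  define d where "d m l = 2 * ?mu m (l - 1) - ?mu m l" for m l
  \<comment> \<open>The double sum dominates the sum of \<open>\<bar>d m l\<bar>\<close> over
    \<open>m\<close> for each single \<open>l\<close>; the added 1 gives \<open>C \<ge> 1\<close>,
    which forces \<open>z\<close> to be decreasing.\<close>
  define C where "C = 1 + (\<Sum>l\<le>N. \<Sum>m\<le>N. \<bar>d m l\<bar>)"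
  have C1: "C \<ge> 1"
    unfolding C_def by (simp add: sum_nonneg)
  have "mono_on {0..N} (formal_h N b lam z)"
    if nonneg: "\<forall>i\<in>{0..N}. z i \<ge> 0" and dec: "\<forall>l\<in>{1..N}. z (l - 1) \<ge> C * z l" for z
    unfolding mono_on_formal_h_iff_q_vec
  proof
    fix l assume l: "l \<in> {1..N}"
    \<comment> \<open>Hence all entries from index \<open>l\<close> on are bounded by
      \<open>z l\<close>, and one multiple of \<open>z l\<close> controls the whole sum.\<close>
    have antimono: "z m \<le> z l" if "l \<le> m" "m \<le> N" for m
      using that
    proof (induction m rule: dec_induct)
      case (step m)
      have "z (Suc m) \<le> C * z (Suc m)"
        using mult_right_mono[OF C1, of "z (Suc m)"] nonneg step.prems by simp
      also have "\<dots> \<le> z m"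
        using dec step.prems by (metis atLeastAtMost_iff diff_Suc_1 le_add1 plus_1_eq_Suc)
      finally show ?case
        using step by simp
    qed simp
    have "- (\<Sum>m = l..N. d m l * z m) \<le> (\<Sum>m = l..N. \<bar>d m l\<bar> * z l)"
      unfolding sum_negf[symmetric]
    proof (rule sum_mono)
      fix m assume m: "m \<in> {l..N}"
      have "- (d m l * z m) \<le> \<bar>d m l\<bar> * z m"
        using nonneg m by (metis abs_ge_minus_self atLeastAtMost_iff le0 mult_minus_left mult_right_mono)
      also have "\<dots> \<le> \<bar>d m l\<bar> * z l"
        using antimono m by (intro mult_left_mono) auto
      finally show "- (d m l * z m) \<le> \<bar>d m l\<bar> * z l" .
    qed
    also have "\<dots> = (\<Sum>m = l..N. \<bar>d m l\<bar>) * z l"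
      by (simp add: sum_distrib_right)
    also have "\<dots> \<le> C * z l"
    proof (rule mult_right_mono)
      have "(\<Sum>m = l..N. \<bar>d m l\<bar>) \<le> (\<Sum>m\<le>N. \<bar>d m l\<bar>)"
        by (rule sum_mono2) auto
      also have "\<dots> \<le> (\<Sum>l\<le>N. \<Sum>m\<le>N. \<bar>d m l\<bar>)"
        using l by (intro member_le_sum) (auto simp: sum_nonneg)
      finally show "(\<Sum>m = l..N. \<bar>d m l\<bar>) \<le> C"
        by (simp add: C_def)
      show "0 \<le> z l"
        using nonneg l by simp
    qed
    also have "\<dots> \<le> z (l - 1)"
      using dec l by blast
    finally have "- (\<Sum>m = l..N. d m l * z m) \<le> z (l - 1)" .
    moreover have "(\<Sum>m = l..N. d m l * z m) =
        (2 * ?mu l (l - 1) - 1) * z l + (\<Sum>m = l + 1..N. d m l * z m)"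
      using l by (simp add: sum.atLeast_Suc_atMost motzkin_mu_diag d_def)
    moreover have "z (l - 1) \<ge> 0"
      using nonneg l by auto
    \<comment> \<open>The estimate was obtained without the factor 1/2; since
      \<open>z (l - 1)\<close> is nonnegative, halving the left side preserves it.\<close>
    moreover have "- (1 / 2) * (x + y) \<le> c" if "- u \<le> c" "u = x + y" "0 \<le> c" for x y u c :: real
      using that by argo
    ultimately show "q_vec N b lam z l \<le> 2 * q_vec N b lam z (l - 1)"
      unfolding q_vec_le_iff[OF l] d_def by blast
  qed
  with C1 show ?thesis
    by blast
qed

text \<open>The hypothesis at \<open>s = l\<close> makes every coefficient of \<open>z\<close> in
  the bracket nonnegative, so the right-hand side is at most 0. The first coefficient is the case
  \<open>r = l\<close>, where mu_{l,l} = 1.\<close>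

lemma rhs_le_if_doubled_mu:
  assumes mu: "\<forall>r\<in>{0..N}. \<forall>s\<in>{1..N}. motzkin_mu N b lam r s \<le> 2 * motzkin_mu N b lam r (s - 1)"
    and nonneg: "\<forall>i\<in>{0..N}. (z i :: real) \<ge> 0"
    and l: "l \<in> {1..N}"
  shows "z (l - 1) \<ge> - (1 / 2) * ((2 * motzkin_mu N b lam l (l - 1) - 1) * z l
    + (\<Sum>m = l + 1..N. (2 * motzkin_mu N b lam m (l - 1) - motzkin_mu N b lam m l) * z m))"
proof -
  let ?mu = "motzkin_mu N b lam"
  have d: "2 * ?mu m (l - 1) - ?mu m l \<ge> 0" if "m \<le> N" for m
    using mu l that by simp
  have "(\<Sum>m = l + 1..N. (2 * ?mu m (l - 1) - ?mu m l) * z m) \<ge> 0"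
    using d nonneg by (intro sum_nonneg mult_nonneg_nonneg) auto
  moreover have "(2 * ?mu l (l - 1) - 1) * z l \<ge> 0"
    using d[of l] nonneg l by (intro mult_nonneg_nonneg) (auto simp: motzkin_mu_diag)
  moreover have "z (l - 1) \<ge> 0"
    using nonneg l by auto
  moreover have "- (1 / 2) * (x + y) \<le> c" if "0 \<le> y" "0 \<le> x" "0 \<le> c" for x y c :: real
    using that by argo
  ultimately show ?thesis
    by blast
qed

theorem proposition3p8:
  fixes N :: nat and b lam :: "nat \<Rightarrow> real"
  assumes b_pos: "\<forall>i\<in>{0..N}. b i > 0"
    and lam_pos: "\<forall>j\<in>{1..N}. lam j > 0"
  shows
    "(\<forall>z :: nat \<Rightarrow> real. (\<forall>i\<in>{0..N}. z i \<ge> 0) \<longrightarrow>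
        (mono_on {0..N} (formal_h N b lam z) \<longleftrightarrow>
         (\<forall>l\<in>{1..N}. z (l - 1) \<ge>
            - (1 / 2) * ((2 * motzkin_mu N b lam l (l - 1) - 1) * z l
              + (\<Sum>m = l + 1..N.
                   (2 * motzkin_mu N b lam m (l - 1) - motzkin_mu N b lam m l) * z m))))) \<and>
     (\<exists>C::real. C \<ge> 1 \<and> ( \<forall>z :: nat \<Rightarrow> real. (\<forall>i\<in>{0..N}. z i \<ge> 0) \<longrightarrow>
        (\<forall>l\<in>{1..N}. z (l - 1) \<ge> C * z l) \<longrightarrow>
        (\<exists>h. gen_inverted_gamma N b lam h z \<and> mono_on {0..N} h))) \<and>
     ((\<forall>r\<in>{0..N}. \<forall>s\<in>{1..N}. motzkin_mu N b lam r s \<le> 2 * motzkin_mu N b lam r (s - 1)) \<longrightarrow>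
        (\<forall>z :: nat \<Rightarrow> real. (\<forall>i\<in>{0..N}. z i \<ge> 0) \<longrightarrow>
         (\<forall>l\<in>{1..N}. z (l - 1) \<ge>
            - (1 / 2) * ((2 * motzkin_mu N b lam l (l - 1) - 1) * z l
              + (\<Sum>m = l + 1..N.
                   (2 * motzkin_mu N b lam m (l - 1) - motzkin_mu N b lam m l) * z m)))))"
proof (intro conjI allI impI ballI)
  show "mono_on {0..N} (formal_h N b lam z) \<longleftrightarrow>
      (\<forall>l\<in>{1..N}. z (l - 1) \<ge>
        - (1 / 2) * ((2 * motzkin_mu N b lam l (l - 1) - 1) * z l
          + (\<Sum>m = l + 1..N.
               (2 * motzkin_mu N b lam m (l - 1) - motzkin_mu N b lam m l) * z m)))" for z
    unfolding mono_on_formal_h_iff_q_vec by (intro ball_cong refl q_vec_le_iff)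
next
  show "\<exists>C::real. C \<ge> 1 \<and> (\<forall>z :: nat \<Rightarrow> real. (\<forall>i\<in>{0..N}. z i \<ge> 0) \<longrightarrow>
      (\<forall>l\<in>{1..N}. z (l - 1) \<ge> C * z l) \<longrightarrow>
      (\<exists>h. gen_inverted_gamma N b lam h z \<and> mono_on {0..N} h))"
    \<comment> \<open>The witness for h is \<open>formal_h N b lam z\<close>.\<close>
    using mono_on_formal_h_if_rapid_decrease[of N b lam] gen_inverted_gamma_formal_h[of N b lam]
    by meson
qed (rule rhs_le_if_doubled_mu)

end
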